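(* Let $G$ be a closed subgroup of $\operatorname{SL}_2(\mathbb{Z}_2)$ whose reduction modulo $4$ is trivial, and let $s\ge 2$ be an integer. If $L(G)$ contains $2^{s}\mathfrak{sl}_2(\mathbb{Z}_2)$, then $G$ contains $\mathcal{B}_2(6s)$.
   Context: $\Theta(g)=g-\frac{\operatorname{tr}(g)}{2}\operatorname{Id}\in\mathfrak{sl}_2(\mathbb{Z}_2)$ for $g\in G$, and $L(G)$ is the closed subgroup of $\mathfrak{sl}_2(\mathbb{Z}_2)$ (trace-zero $2\times2$ matrices over $\mathbb{Z}_2$) topologically generated by $\Theta(G)$. $\mathcal{B}_2(n)=\{g\in\operatorname{SL}_2(\mathbb{Z}_2):g\equiv\operatorname{Id}\pmod{2^n}\}$. *)

theory Defs
  imports "HOL-Analysis.Analysis" "HOL-Algebra.Group" "HOL-Computational_Algebra.Primes"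
begin

text \<open>The ring of 2-adic integers as the inverse limit of the rings of residues modulo \<open>2 ^ n\<close>:
  the \<open>n\<close>-th entry is the representative in \<open>{0..<2 ^ n}\<close> of the residue modulo \<open>2 ^ n\<close>.\<close>

typedef z2 = "{x :: nat \<Rightarrow> int. \<forall>n. 0 \<le> x n \<and> x n < 2 ^ n \<and> x (Suc n) mod 2 ^ n = x n}"
  morphisms res Abs_z2
  by (rule exI[of _ "\<lambda>_. 0"]) simp

setup_lifting type_definition_z2

lemma res_bounds: "0 \<le> res x n" "res x n < 2 ^ n"
  using res[of x] by auto

lemma res_0 [simp]: "res x 0 = 0"
  using res_bounds[of x 0] by simp

lemma res_Suc_mod: "res x (Suc n) mod 2 ^ n = res x n"
  using res[of x] by auto

lemma res_mod_self [simp]: "res x n mod 2 ^ n = res x n"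
  by (simp add: res_bounds)

lemma res_mod: "m \<le> n \<Longrightarrow> res x n mod 2 ^ m = res x m"
proof (induction n)
  case (Suc n)
  show ?case
  proof (cases "m = Suc n")
    case False
    with Suc.prems have "m \<le> n" by simp
    then have "res x (Suc n) mod 2 ^ n mod 2 ^ m = res x (Suc n) mod 2 ^ m"
      by (simp add: mod_mod_cancel le_imp_power_dvd)
    with Suc.IH \<open>m \<le> n\<close> show ?thesis by (simp add: res_Suc_mod)
  qed (simp del: power_Suc)
qed simp

lemma z2_eqI: "(\<And>n. res x n = res y n) \<Longrightarrow> x = y"
  by (metis res_inject ext)

lemma mod_pow_Suc_mod: "(a :: int) mod 2 ^ Suc n mod 2 ^ n = a mod 2 ^ n"
  by (rule mod_mod_cancel) simp

instantiation z2 :: comm_ring_1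
begin

lift_definition zero_z2 :: z2 is "\<lambda>_. 0" by simp

lift_definition one_z2 :: z2 is "\<lambda>n. 1 mod 2 ^ n"
  by (auto simp: mod_pow_Suc_mod simp del: power_Suc)

lift_definition plus_z2 :: "z2 \<Rightarrow> z2 \<Rightarrow> z2" is "\<lambda>x y n. (x n + y n) mod 2 ^ n"
  by (auto simp: mod_pow_Suc_mod simp del: power_Suc) (metis mod_add_eq mod_mod_trivial)

lift_definition minus_z2 :: "z2 \<Rightarrow> z2 \<Rightarrow> z2" is "\<lambda>x y n. (x n - y n) mod 2 ^ n"
  by (auto simp: mod_pow_Suc_mod simp del: power_Suc) (metis mod_diff_eq mod_mod_trivial)

lift_definition uminus_z2 :: "z2 \<Rightarrow> z2" is "\<lambda>x n. (- x n) mod 2 ^ n"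
  by (auto simp: mod_pow_Suc_mod simp del: power_Suc) (metis mod_minus_eq mod_mod_trivial)

lift_definition times_z2 :: "z2 \<Rightarrow> z2 \<Rightarrow> z2" is "\<lambda>x y n. (x n * y n) mod 2 ^ n"
  by (auto simp: mod_pow_Suc_mod simp del: power_Suc) (metis mod_mult_eq mod_mod_trivial)

instance
proof
  fix a b c :: z2
  show "a * b * c = a * (b * c)"
    by (rule z2_eqI) (simp add: times_z2.rep_eq mod_simps mult.assoc)
  show "a * b = b * a"
    by (rule z2_eqI) (simp add: times_z2.rep_eq mult.commute)
  show "1 * a = a"
    by (rule z2_eqI) (simp add: times_z2.rep_eq one_z2.rep_eq mod_simps)
  show "a + b + c = a + (b + c)"
    by (rule z2_eqI) (simp add: plus_z2.rep_eq mod_simps add.assoc)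
  show "a + b = b + a"
    by (rule z2_eqI) (simp add: plus_z2.rep_eq add.commute)
  show "0 + a = a"
    by (rule z2_eqI) (simp add: plus_z2.rep_eq zero_z2.rep_eq)
  show "- a + a = 0"
    by (rule z2_eqI) (simp add: plus_z2.rep_eq uminus_z2.rep_eq zero_z2.rep_eq mod_simps)
  show "a - b = a + - b"
    by (rule z2_eqI) (simp add: plus_z2.rep_eq uminus_z2.rep_eq minus_z2.rep_eq mod_simps)
  show "(a + b) * c = a * c + b * c"
    by (rule z2_eqI) (simp add: plus_z2.rep_eq times_z2.rep_eq mod_simps distrib_right)
  have "res (0::z2) 1 \<noteq> res 1 1"
    by (simp add: zero_z2.rep_eq one_z2.rep_eq)
  then show "(0::z2) \<noteq> 1" by auto
qed

end

lemma z2_no_zero_divisors: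
  fixes a b :: z2
  assumes "a \<noteq> 0" "b \<noteq> 0"
  shows "a * b \<noteq> 0"
proof
  assume 0: "a * b = 0"
  obtain m n where "res a m \<noteq> 0" "res b n \<noteq> 0"
    using assms by (metis z2_eqI zero_z2.rep_eq)
  then have nd: "\<not> 2 ^ m dvd res a (m + n)" "\<not> 2 ^ n dvd res b (m + n)"
    by (simp_all add: dvd_eq_mod_eq_0 res_mod)
  have "2 ^ (m + n) dvd res a (m + n) * res b (m + n)"
    using arg_cong[OF 0, of "\<lambda>x. res x (m + n)"]
    by (simp add: times_z2.rep_eq zero_z2.rep_eq dvd_eq_mod_eq_0)
  then have "2 ^ (m + n - 1) dvd res a (m + n) * res b (m + n)"
    by (rule power_le_dvd) simp
  moreover have "m + n = Suc (m + n - 1)"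
    using \<open>res a m \<noteq> 0\<close> by (cases m) auto
  ultimately show False
    using prime_elem_power_dvd_cases[of "2::int" "m + n - 1" "res a (m + n)" "res b (m + n)" m n] nd
    by auto
qed

instantiation z2 :: idom_divide
begin

text \<open>Exact division: the value is only meaningful if \<open>y\<close> is nonzero and divides \<open>x\<close>.\<close>

definition divide_z2 :: "z2 \<Rightarrow> z2 \<Rightarrow> z2"
  where "divide_z2 x y = (if y = 0 then 0 else THE z. z * y = x)"

instance
proof
  fix a b :: z2
  show "a \<noteq> 0 \<Longrightarrow> b \<noteq> 0 \<Longrightarrow> a * b \<noteq> 0"
    by (rule z2_no_zero_divisors)
  show "a div 0 = 0"
    by (simp add: divide_z2_def)
  assume "b \<noteq> 0"
  have "z = a" if "z * b = a * b" for z
  proof -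
    have "(z - a) * b = 0" using that by (simp add: algebra_simps)
    with \<open>b \<noteq> 0\<close> z2_no_zero_divisors[of "z - a" b] show ?thesis by auto
  qed
  with \<open>b \<noteq> 0\<close> show "a * b div b = a"
    by (auto simp: divide_z2_def intro!: the_equality)
qed

end

text \<open>The 2-adic metric: distinct \<open>x\<close> and \<open>y\<close> have distance \<open>1 / 2 ^ v\<close>, where \<open>v\<close> is the
  largest number such that \<open>x\<close> and \<open>y\<close> agree modulo \<open>2 ^ v\<close>, i.e. the least one such that they
  differ modulo \<open>2 ^ Suc v\<close>.\<close>

instantiation z2 :: metric_space
begin

definition dist_z2 :: "z2 \<Rightarrow> z2 \<Rightarrow> real"
  where "dist x y = (if x = y then 0 else 1 / 2 ^ (LEAST v. res x (Suc v) \<noteq> res y (Suc v)))"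

definition uniformity_z2 :: "(z2 \<times> z2) filter"
  where "uniformity = (INF e\<in>{0 <..}. principal {(x :: z2, y). dist x y < e})"

definition open_z2 :: "z2 set \<Rightarrow> bool"
  where "open_z2 U = (\<forall>x\<in>U. eventually (\<lambda>(x', y). x' = x \<longrightarrow> y \<in> U) uniformity)"

lemma dist_z2_le_iff: "dist x y \<le> 1 / 2 ^ n \<longleftrightarrow> res x n = res y n" for x y :: z2
proof (cases "x = y")
  case False
  define v where "v = (LEAST v. res x (Suc v) \<noteq> res y (Suc v))"
  obtain k where "res x k \<noteq> res y k" using False z2_eqI by blast
  then obtain k' where "res x (Suc k') \<noteq> res y (Suc k')" by (cases k) auto
  then have v1: "res x (Suc v) \<noteq> res y (Suc v)" unfolding v_def by (rule LeastI)
  have v2: "res x (Suc w) = res y (Suc w)" if "w < v" for w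
    using not_less_Least that unfolding v_def by blast
  have "res x n = res y n \<longleftrightarrow> n \<le> v"
  proof
    assume "res x n = res y n"
    with v1 have "\<not> Suc v \<le> n" by (auto simp flip: res_mod)
    then show "n \<le> v" by simp
  next
    assume "n \<le> v"
    then show "res x n = res y n" using v2 by (cases n) auto
  qed
  moreover have "dist x y = 1 / 2 ^ v" using False by (simp add: dist_z2_def v_def)
  moreover have "1 / 2 ^ v \<le> (1 / 2 ^ n :: real) \<longleftrightarrow> n \<le> v"
  proof -
    have "1 / 2 ^ v \<le> (1 / 2 ^ n :: real) \<longleftrightarrow> (2 :: real) ^ n \<le> 2 ^ v"
      by (simp add: field_simps)
    then show ?thesis by simp
  qed
  ultimately show ?thesis by simp
qed (simp add: dist_z2_def)

instance
proof
  show "uniformity = (INF e\<in>{0 <..}. principal {(x :: z2, y). dist x y < e})"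
    by (rule uniformity_z2_def)
  show "open U = (\<forall>x\<in>U. eventually (\<lambda>(x', y). x' = x \<longrightarrow> y \<in> U) uniformity)" for U :: "z2 set"
    by (rule open_z2_def)
  show "dist x y = 0 \<longleftrightarrow> x = y" for x y :: z2
    by (simp add: dist_z2_def)
  show "dist x y \<le> dist x z + dist y z" for x y z :: z2
  proof -
    have nonneg: "0 \<le> dist a b" for a b :: z2 by (simp add: dist_z2_def)
    have form: "a \<noteq> b \<Longrightarrow> \<exists>n. dist a b = 1 / 2 ^ n" for a b :: z2 by (auto simp: dist_z2_def)
    have ultra: "dist x y \<le> 1 / 2 ^ n" if "dist x z \<le> 1 / 2 ^ n" "dist y z \<le> 1 / 2 ^ n" for n
      using that by (simp add: dist_z2_le_iff)
    show ?thesis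
    proof (cases "x = z \<or> y = z")
      case True
      moreover have "dist x y = dist y x" unfolding dist_z2_def by (simp only: eq_commute)
      moreover have "dist z z = 0" for z :: z2 by (simp add: dist_z2_def)
      ultimately show ?thesis using nonneg[of x y] nonneg[of y x] by (elim disjE) simp_all
    next
      case False
      then obtain m n where mn: "dist x z = 1 / 2 ^ m" "dist y z = 1 / 2 ^ n"
        using form[of x z] form[of y z] by blast
      show ?thesis
      proof (cases "dist x z \<le> dist y z")
        case True
        with ultra[of n] mn have "dist x y \<le> dist y z" by simp
        with nonneg[of x z] show ?thesis by linarith
      next
        case False
        with ultra[of m] mn have "dist x y \<le> dist x z" by simp
        with nonneg[of y z] show ?thesis by linarith
      qed
    qed
  qed
qed

end

lemma res_of_nat: "res (of_nat k) n = int k mod 2 ^ n"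
  by (induction k) (simp_all add: zero_z2.rep_eq plus_z2.rep_eq one_z2.rep_eq mod_simps)

lemma res_two_power: "res (2 ^ k) n = 2 ^ k mod 2 ^ n"
  using res_of_nat[of "2 ^ k" n] by simp

lemma z2_two_power_dvd_iff: "2 ^ n dvd x \<longleftrightarrow> res x n = 0" for x :: z2
proof
  assume "2 ^ n dvd x"
  then show "res x n = 0" by (auto elim!: dvdE simp: times_z2.rep_eq res_two_power)
next
  assume 0: "res x n = 0"
  define y where "y m = res x (m + n) div 2 ^ n" for m
  have eq: "2 ^ n * y m = res x (m + n)" for m
    using 0 res_mod[of n "m + n" x] by (simp add: y_def dvd_eq_mod_eq_0)
  have "y \<in> {x. \<forall>n. 0 \<le> x n \<and> x n < 2 ^ n \<and> x (Suc n) mod 2 ^ n = x n}"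
  proof (intro CollectI allI conjI)
    fix m
    show "0 \<le> y m" by (simp add: y_def res_bounds pos_imp_zdiv_nonneg_iff)
    have "2 ^ n * y m < 2 ^ n * 2 ^ m"
      using eq[of m] res_bounds(2)[of x "m + n"] by (simp add: power_add mult.commute)
    then show "y m < 2 ^ m" by simp
    have "2 ^ n * (y (Suc m) mod 2 ^ m) = (2 ^ n * y (Suc m)) mod (2 ^ n * 2 ^ m)"
      by (rule mult_mod_right)
    also have "\<dots> = res x (Suc (m + n)) mod 2 ^ (m + n)"
      unfolding eq by (simp add: power_add mult.commute)
    also have "\<dots> = 2 ^ n * y m"
      by (simp add: eq res_Suc_mod)
    finally show "y (Suc m) mod 2 ^ m = y m" by simp
  qed
  then have res_y: "res (Abs_z2 y) = y" by (rule Abs_z2_inverse)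
  have "x = 2 ^ n * Abs_z2 y"
  proof (rule z2_eqI)
    fix m
    have "res (2 ^ n * Abs_z2 y) m = (2 ^ n * y m) mod 2 ^ m"
      by (simp add: times_z2.rep_eq res_two_power res_y mod_simps)
    also have "\<dots> = res x m" by (simp add: eq res_mod)
    finally show "res x m = res (2 ^ n * Abs_z2 y) m" by simp
  qed
  then show "2 ^ n dvd x" by (rule dvdI)
qed

type_synonym mat2 = "z2 ^ 2 ^ 2"

text \<open>On matrices \<open>**\<close> and \<open>mat 1\<close> are the ring operations; \<open>*\<close> and \<open>1\<close> would be entrywise.\<close>

definition SL2 :: "mat2 monoid"
  where "SL2 = \<lparr>carrier = {A. det A = 1}, mult = (**), one = mat 1\<rparr>"

definition sl2 :: "mat2 monoid"
  where "sl2 = \<lparr>carrier = {A. trace A = 0}, mult = (+), one = 0\<rparr>"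

definition scal :: "z2 \<Rightarrow> mat2 \<Rightarrow> mat2"
  where "scal c A = (\<chi> i j. c * A $ i $ j)"

definition mat_cong :: "z2 \<Rightarrow> mat2 \<Rightarrow> mat2 \<Rightarrow> bool"
  where "mat_cong m A B \<longleftrightarrow> (\<forall>i j. m dvd A $ i $ j - B $ i $ j)"

definition \<Theta> :: "mat2 \<Rightarrow> mat2"
  where "\<Theta> g = g - scal (trace g div 2) (mat 1)"

definition L :: "mat2 set \<Rightarrow> mat2 set"
  where "L G = (\<lambda>H. subgroup H sl2 \<and> closed H) hull (\<Theta> ` G)"

definition B2 :: "nat \<Rightarrow> mat2 set"
  where "B2 n = {g \<in> carrier SL2. mat_cong (2 ^ n) g (mat 1)}"

lemma group_SL2: "group SL2"
proof (rule groupI)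
  fix A assume "A \<in> carrier SL2"
  then have d: "A $ 1 $ 1 * A $ 2 $ 2 - A $ 1 $ 2 * A $ 2 $ 1 = 1"
    by (simp add: SL2_def det_2)
  define B :: mat2 where "B = vector [vector [A $ 2 $ 2, - A $ 1 $ 2], vector [- A $ 2 $ 1, A $ 1 $ 1]]"
  have "B ** A = mat 1" "det B = 1"
    using d by (auto simp: B_def det_2 vec_eq_iff forall_2 matrix_matrix_mult_def sum_2 mat_def algebra_simps)
  then show "\<exists>B\<in>carrier SL2. B \<otimes>\<^bsub>SL2\<^esub> A = \<one>\<^bsub>SL2\<^esub>"
    by (auto simp: SL2_def)
qed (auto simp: SL2_def det_mul matrix_mul_assoc)

lemma group_sl2: "group sl2"
proof (rule groupI)
  fix A assume "A \<in> carrier sl2"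
  then show "\<exists>B\<in>carrier sl2. B \<otimes>\<^bsub>sl2\<^esub> A = \<one>\<^bsub>sl2\<^esub>"
    using trace_sub[of 0 A] by (intro bexI[of _ "- A"]) (auto simp: sl2_def trace_def)
next
  show "\<one>\<^bsub>sl2\<^esub> \<in> carrier sl2" by (simp add: sl2_def trace_def)
qed (auto simp: sl2_def trace_add add.assoc)

lemma closed_sl2: "closed (carrier sl2)"
proof -
  have "\<exists>e>0. ball A e \<subseteq> - carrier sl2" if "A \<in> - carrier sl2" for A
  proof -
    from that have "trace A \<noteq> 0" by (simp add: sl2_def)
    then obtain n where n: "res (trace A) n \<noteq> 0" by (metis z2_eqI zero_z2.rep_eq)
    have "B \<notin> carrier sl2" if B: "dist A B < 1 / 2 ^ n" for B
    proof -
      have "dist (A $ i $ j) (B $ i $ j) \<le> 1 / 2 ^ n" for i j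
        using B dist_vec_nth_le[of "A $ i" j "B $ i"] dist_vec_nth_le[of A i B] by linarith
      then have "res (A $ i $ j) n = res (B $ i $ j) n" for i j
        by (simp add: dist_z2_le_iff)
      then have "res (trace B) n = res (trace A) n"
        by (simp add: trace_def sum_2 plus_z2.rep_eq)
      with n show ?thesis by (auto simp: sl2_def zero_z2.rep_eq)
    qed
    then show ?thesis by (intro exI[of _ "1 / 2 ^ n"]) (auto simp: ball_def)
  qed
  then show ?thesis by (simp add: closed_def open_contains_ball)
qed

text \<open>For matrices congruent to the identity modulo 4, the division in \<open>\<Theta>\<close> is exact and \<open>\<Theta>\<close>
  takes values in \<open>sl2\<close>.\<close>

lemma two_dvd_trace:
  assumes "mat_cong 4 g (mat 1)"
  shows "2 dvd trace g"
proof -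
  have "2 dvd (4 :: z2)" by (rule dvdI[of _ _ 2]) simp
  with assms have "2 dvd g $ 1 $ 1 - 1" "2 dvd g $ 2 $ 2 - 1"
    by (auto simp: mat_cong_def mat_def forall_2 intro: dvd_trans)
  then have "2 dvd (g $ 1 $ 1 - 1) + (g $ 2 $ 2 - 1) + 2" by (intro dvd_add) auto
  then show ?thesis by (simp add: trace_def sum_2 algebra_simps)
qed

lemma \<Theta>_in_sl2:
  assumes "mat_cong 4 g (mat 1)"
  shows "\<Theta> g \<in> carrier sl2"
proof -
  obtain t where t: "trace g = 2 * t" using two_dvd_trace[OF assms] by (elim dvdE)
  have "(2 :: z2) \<noteq> 0"
  proof
    assume "(2 :: z2) = 0"
    then have "res 2 2 = 0" by (simp add: zero_z2.rep_eq)
    then show False using res_of_nat[of 2 2] by simp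
  qed
  then have "trace g div 2 = t" by (simp add: t)
  moreover have "trace (scal t (mat 1)) = 2 * t"
    by (simp add: trace_def sum_2 scal_def mat_def)
  ultimately show ?thesis by (simp add: \<Theta>_def sl2_def trace_sub t)
qed

end

theory Submission
  imports Defs
begin

text \<open>Fix \<open>k\<close>. By Cayley--Hamilton, repeated squaring of \<open>g = t + \<Theta> g\<close> yields
  \<open>g ^ 2 ^ k = c + 2 ^ k u \<Theta> g\<close> for scalars \<open>c \<equiv> 1\<close> modulo \<open>2 ^ (2 * k)\<close> and an odd \<open>u\<close>.
  On the other hand the matrices \<open>A\<close> such that \<open>1 + 2 ^ k A\<close> is congruent modulo \<open>2 ^ (2 * k)\<close> to
  an element of \<open>G\<close> form a closed \<open>\<int>\<^sub>2\<close>-module. It contains \<open>\<Theta> g\<close>, since \<open>u\<close> is invertible, and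
  hence \<open>L G\<close>. So \<open>G\<close> contains an element congruent to \<open>1 + 2 ^ (k + s) X\<close> modulo \<open>2 ^ (2 * k)\<close>
  for every \<open>X\<close> of trace zero, and successive approximation in the closed group \<open>G\<close> concludes.\<close>

section \<open>Entrywise calculus and congruences of 2 by 2 matrices\<close>

lemma mat2_eq_iff:
  "A = B \<longleftrightarrow> A $ 1 $ 1 = B $ 1 $ 1 \<and> A $ 1 $ 2 = B $ 1 $ 2 \<and> A $ 2 $ 1 = B $ 2 $ 1 \<and> A $ 2 $ 2 = B $ 2 $ 2"
  for A B :: mat2
  by (auto simp: vec_eq_iff forall_2)

lemma scal_nth [simp]: "scal c A $ i $ j = c * A $ i $ j"
  by (simp add: scal_def)

lemma mat_nth_2 [simp]:
  "mat c $ (1::2) $ (1::2) = c" "mat c $ (1::2) $ (2::2) = 0"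
  "mat c $ (2::2) $ (1::2) = 0" "mat c $ (2::2) $ (2::2) = c"
  by (simp_all add: mat_def)

lemma matrix_mult_nth_2: "(A ** B) $ i $ j = A $ i $ 1 * B $ 1 $ j + A $ i $ 2 * B $ 2 $ j"
  for A B :: mat2
  by (simp add: matrix_matrix_mult_def sum_2)

lemma mat_cong_refl: "mat_cong m A A"
  by (simp add: mat_cong_def)

lemma mat_cong_sym: "mat_cong m A B \<Longrightarrow> mat_cong m B A"
  unfolding mat_cong_def by (metis dvd_minus_iff minus_diff_eq)

lemma mat_cong_trans:
  assumes "mat_cong m A B" "mat_cong m B C"
  shows "mat_cong m A C"
  unfolding mat_cong_def
proof (intro allI)
  fix i j
  have "m dvd (A $ i $ j - B $ i $ j) + (B $ i $ j - C $ i $ j)"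
    using assms unfolding mat_cong_def by (intro dvd_add) auto
  then show "m dvd A $ i $ j - C $ i $ j" by simp
qed

lemma mat_cong_dvd: "mat_cong m A B \<Longrightarrow> m' dvd m \<Longrightarrow> mat_cong m' A B"
  unfolding mat_cong_def by (blast intro: dvd_trans)

lemma mat_cong_mult:
  assumes "mat_cong m A B" "mat_cong m C D"
  shows "mat_cong m (A ** C) (B ** D)"
  unfolding mat_cong_def
proof (intro allI)
  fix i j
  have "m dvd (A $ i $ k - B $ i $ k) * C $ k $ j + B $ i $ k * (C $ k $ j - D $ k $ j)" for k
    using assms by (simp add: mat_cong_def)
  from dvd_add[OF this[of 1] this[of 2]]
  show "m dvd (A ** C) $ i $ j - (B ** D) $ i $ j"
    by (simp add: matrix_mult_nth_2 algebra_simps)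
qed

section \<open>Congruences and odd elements in the 2-adic integers\<close>

lemma res_eq_iff_dvd: "res x n = res y n \<longleftrightarrow> 2 ^ n dvd x - y"
proof -
  have "2 ^ n dvd x - y \<longleftrightarrow> 2 ^ n dvd res x n - res y n"
    by (simp add: z2_two_power_dvd_iff minus_z2.rep_eq dvd_eq_mod_eq_0)
  also have "\<dots> \<longleftrightarrow> res x n mod 2 ^ n = res y n mod 2 ^ n"
    by (simp only: mod_eq_dvd_iff)
  finally show ?thesis by simp
qed

lemma z2_two_neq_zero: "(2 :: z2) \<noteq> 0"
  using res_of_nat[of 2 2] by (auto simp: zero_z2.rep_eq)

text \<open>Truncated geometric series: with \<open>r = 1 - u\<close> even, the sum of the first
  \<open>k\<close> powers of \<open>r\<close> times \<open>u\<close> is \<open>1 - r ^ k\<close>,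
  and \<open>2 ^ k\<close> divides \<open>r ^ k\<close>.\<close>

lemma odd_inverse_mod:
  fixes u :: z2
  assumes "2 dvd u - 1"
  obtains c where "2 ^ k dvd c * u - 1"
proof
  have "2 dvd 1 - u" using assms dvd_minus_iff[of 2 "u - 1"] by simp
  then have "2 ^ k dvd (1 - u) ^ k" by (rule dvd_power_same)
  also have "(1 - u) ^ k = - ((\<Sum>i<k. (1 - u) ^ i) * u - 1)"
    using power_diff_1_eq[of "1 - u" k] by (simp add: algebra_simps)
  finally show "2 ^ k dvd (\<Sum>i<k. (1 - u) ^ i) * u - 1" by (simp only: dvd_minus_iff)
qed

section \<open>The metric on matrices compared with congruences\<close>

lemma mat_cong_if_dist_less:
  assumes "dist A B < 1 / 2 ^ n"
  shows "mat_cong (2 ^ n) A B"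
proof -
  have "dist (A $ i $ j) (B $ i $ j) \<le> 1 / 2 ^ n" for i j
    using assms dist_vec_nth_le[of "A $ i" j "B $ i"] dist_vec_nth_le[of A i B] by linarith
  then show ?thesis by (simp add: mat_cong_def dist_z2_le_iff flip: res_eq_iff_dvd)
qed

lemma dist_le_if_mat_cong:
  assumes "mat_cong (2 ^ n) A B"
  shows "dist A B \<le> 4 / 2 ^ n"
proof -
  have entry: "dist (A $ i $ j) (B $ i $ j) \<le> 1 / 2 ^ n" for i j
    using assms by (simp add: mat_cong_def dist_z2_le_iff res_eq_iff_dvd)
  \<comment> \<open>Bounding the Euclidean norm by the sum, first over the columns and then over the
    rows, adds up four entry distances; hence the constant 4.\<close>
  have "dist (A $ i) (B $ i) \<le> (\<Sum>j\<in>UNIV. dist (A $ i $ j) (B $ i $ j))" for i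
    unfolding dist_vec_def[of "A $ i"] by (rule L2_set_le_sum) simp
  then have row: "dist (A $ i) (B $ i) \<le> 2 / 2 ^ n" for i
    using add_mono[OF entry[of i 1] entry[of i 2]] by (fastforce simp: sum_2 intro: order.trans)
  have "dist A B \<le> (\<Sum>i\<in>UNIV. dist (A $ i) (B $ i))"
    unfolding dist_vec_def[of A] by (rule L2_set_le_sum) simp
  then show ?thesis using row[of 1] row[of 2] by (simp add: sum_2)
qed

text \<open>By symmetry of congruence the complement is also a union of residue classes, and every
  class contains a ball around each of its points.\<close>

lemma closed_if_mat_cong_invariant:
  assumes "\<And>A B. A \<in> T \<Longrightarrow> mat_cong (2 ^ n) A B \<Longrightarrow> B \<in> T"
  shows "closed T"
proof -
  have "ball A (1 / 2 ^ n) \<subseteq> - T" if "A \<in> - T" for A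
    using that assms mat_cong_sym[OF mat_cong_if_dist_less] by (auto simp: ball_def)
  moreover have "(0::real) < 1 / 2 ^ n" by simp
  ultimately show ?thesis unfolding closed_def open_contains_ball by blast
qed

lemma closed_mat_cong_approx:
  assumes "closed T" "\<And>n. \<exists>B\<in>T. mat_cong (2 ^ n) B A"
  shows "A \<in> T"
proof -
  have "\<exists>B\<in>T. dist B A < e" if "e > 0" for e
  proof -
    from that obtain n where "(1 / 2) ^ n < e / 4"
      using real_arch_pow_inv[of "e / 4" "1 / 2"] by auto
    then have "4 / 2 ^ n < e" by (simp add: field_simps)
    moreover obtain B where "B \<in> T" "mat_cong (2 ^ n) B A" using assms(2) by blast
    ultimately show ?thesis using dist_le_if_mat_cong by force
  qed
  then show ?thesis using closed_approachable[OF assms(1)] by blast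
qed

section \<open>First-order terms of elements of \<open>G\<close> at level \<open>k\<close>\<close>

text \<open>The modulus is the square of the scale \<open>2 ^ k\<close>: in a product of two
  elements the cross term \<open>2 ^ (2 * k) * A * B\<close> disappears, so multiplication in
  \<open>G\<close> becomes addition of first-order terms, which matter only modulo
  \<open>2 ^ k\<close>.\<close>

definition near :: "mat2 set \<Rightarrow> nat \<Rightarrow> mat2 set"
  where "near G k = {A. \<exists>h\<in>G. mat_cong (2 ^ (2 * k)) h (mat 1 + scal (2 ^ k) A)}"

lemma near_mat_cong:
  assumes "A \<in> near G k" "mat_cong (2 ^ k) A B"
  shows "B \<in> near G k"
proof -
  have "2 ^ k * 2 ^ k dvd 2 ^ k * (A $ i $ j - B $ i $ j)" for i j
    using assms(2) unfolding mat_cong_def by (intro mult_dvd_mono) auto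
  then have "mat_cong (2 ^ (2 * k)) (mat 1 + scal (2 ^ k) A) (mat 1 + scal (2 ^ k) B)"
    by (simp add: mat_cong_def right_diff_distrib mult_2 mult_2_right power_add)
  with assms(1) show ?thesis unfolding near_def by (blast intro: mat_cong_trans)
qed

context
  fixes G :: "mat2 set"
  assumes G: "subgroup G SL2"
begin

lemma mult_in_G: "g \<in> G \<Longrightarrow> h \<in> G \<Longrightarrow> g ** h \<in> G"
  using subgroup.m_closed[OF G] by (simp add: SL2_def)

lemma one_in_G: "mat 1 \<in> G"
  using subgroup.one_closed[OF G] by (simp add: SL2_def)

lemma det_in_G: "g \<in> G \<Longrightarrow> det g = 1"
  using subgroup.subset[OF G] by (auto simp: SL2_def)

lemma near_zero: "0 \<in> near G k"
  unfolding near_def using one_in_G by (auto simp: mat_cong_def intro!: bexI[of _ "mat 1"])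

lemma near_add:
  assumes "A \<in> near G k" "B \<in> near G k"
  shows "A + B \<in> near G k"
proof -
  obtain g h where "g \<in> G" "h \<in> G"
    and c: "mat_cong (2 ^ (2 * k)) g (mat 1 + scal (2 ^ k) A)"
      "mat_cong (2 ^ (2 * k)) h (mat 1 + scal (2 ^ k) B)"
    using assms unfolding near_def by blast
  have "(mat 1 + scal (2 ^ k) A) ** (mat 1 + scal (2 ^ k) B)
      = mat 1 + scal (2 ^ k) (A + B) + scal (2 ^ (2 * k)) (A ** B)"
    by (simp add: mat2_eq_iff matrix_mult_nth_2 algebra_simps mult_2 mult_2_right power_add)
  then have "mat_cong (2 ^ (2 * k)) ((mat 1 + scal (2 ^ k) A) ** (mat 1 + scal (2 ^ k) B))
      (mat 1 + scal (2 ^ k) (A + B))"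
    by (simp add: mat_cong_def)
  with mat_cong_mult[OF c] have "mat_cong (2 ^ (2 * k)) (g ** h) (mat 1 + scal (2 ^ k) (A + B))"
    by (rule mat_cong_trans)
  with mult_in_G[OF \<open>g \<in> G\<close> \<open>h \<in> G\<close>] show ?thesis unfolding near_def by blast
qed

text \<open>Addition gives the natural multiples. They suffice, since every 2-adic integer is
  congruent to a natural number modulo \<open>2 ^ k\<close> and \<open>near\<close> is invariant
  under such congruences.\<close>

lemma near_scal:
  assumes "A \<in> near G k"
  shows "scal c A \<in> near G k"
proof -
  have nat: "scal (of_nat n) A \<in> near G k" for n
  proof (induction n)
    case 0
    have "scal 0 A = 0" by (simp add: mat2_eq_iff)
    then show ?case using near_zero by simp
  next
    case (Suc n)
    have "scal (of_nat (Suc n)) A = A + scal (of_nat n) A"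
      by (simp add: mat2_eq_iff algebra_simps)
    then show ?case using near_add[OF assms Suc.IH] by simp
  qed
  define n where "n = nat (res c k)"
  have "int n = res c k" by (simp add: n_def res_bounds)
  then have "res (of_nat n) k = res c k" by (simp add: res_of_nat)
  then have "2 ^ k dvd of_nat n - c" by (simp add: res_eq_iff_dvd)
  then have "mat_cong (2 ^ k) (scal (of_nat n) A) (scal c A)"
    by (simp add: mat_cong_def flip: left_diff_distrib)
  with nat show ?thesis by (rule near_mat_cong)
qed

section \<open>Repeated squaring of an element of \<open>G\<close>\<close>

text \<open>The witness \<open>h\<close> is the \<open>2 ^ k\<close>-th power of \<open>g\<close>.
  Squaring stays in the span of the identity and \<open>\<Theta> g\<close>, because the square of a
  trace-zero matrix is scalar. The exponent \<open>2 * k + 1\<close> also makes \<open>c\<close> odd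
  for \<open>k = 0\<close>, which keeps the factor \<open>u\<close> odd in the induction.\<close>

lemma power_two_power_in_G:
  assumes "g \<in> G" "mat_cong 4 g (mat 1)"
  shows "\<exists>h\<in>G. \<exists>c u. h = mat c + scal (2 ^ k * u) (\<Theta> g) \<and> 2 ^ (2 * k + 1) dvd c - 1 \<and> 2 dvd u - 1"
proof -
  obtain t where t: "trace g = 2 * t" using two_dvd_trace[OF assms(2)] by (elim dvdE)
  then have \<Theta>: "\<Theta> g = g - mat t"
    by (simp add: \<Theta>_def mat2_eq_iff z2_two_neq_zero)
  have dvds: "4 dvd g $ 1 $ 1 - 1" "4 dvd g $ 2 $ 2 - 1" "4 dvd g $ 1 $ 2" "4 dvd g $ 2 $ 1"
    using assms(2) by (auto simp: mat_cong_def forall_2)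
  then have "2 * 2 dvd (g $ 1 $ 1 - 1) + (g $ 2 $ 2 - 1)" by (intro dvd_add) auto
  also have "\<dots> = 2 * (t - 1)" using t by (simp add: trace_def sum_2 algebra_simps)
  finally have odd_t: "2 dvd t - 1" using z2_two_neq_zero dvd_mult_cancel_left by blast
  define a b c where "a = \<Theta> g $ 1 $ 1" and "b = \<Theta> g $ 1 $ 2" and "c = \<Theta> g $ 2 $ 1"
  have "\<Theta> g $ 2 $ 2 = - a" using t by (simp add: a_def \<Theta> trace_def sum_2 algebra_simps)
  note entries = a_def[symmetric] b_def[symmetric] c_def[symmetric] this
  have 2: "(2::z2) dvd 4" by (rule dvdI[of _ _ 2]) simp
  have "2 dvd (g $ 1 $ 1 - 1) - (t - 1)"
    using odd_t dvds(1) 2 by (meson dvd_diff dvd_trans)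
  then have "2 dvd a" by (simp add: a_def \<Theta>)
  moreover have "2 dvd b" "2 dvd c"
    using dvds 2 by (auto simp: b_def c_def \<Theta> intro: dvd_trans)
  \<comment> \<open>The square of \<open>\<Theta> g\<close> is the scalar
    \<open>a * a + b * c\<close>; all entries of \<open>\<Theta> g\<close> are even, so it is
    divisible by 4.\<close>
  ultimately have "2 * 2 dvd a * a + b * c" by (intro dvd_add mult_dvd_mono)
  then obtain d where d: "a * a + b * c = 4 * d" by (auto elim: dvdE)
  show ?thesis
  proof (induction k)
    case 0
    have "g = mat t + scal (2 ^ 0 * 1) (\<Theta> g)" by (simp add: mat2_eq_iff \<Theta>)
    then show ?case using assms(1) odd_t by (intro bexI[of _ g] exI[of _ t] exI[of _ 1]) simp_all
  next
    case (Suc k)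
    then obtain h x u where h: "h \<in> G" "h = mat x + scal (2 ^ k * u) (\<Theta> g)"
      "2 ^ (2 * k + 1) dvd x - 1" "2 dvd u - 1" by blast
    define e where "e = 2 ^ k * u"
    then have he: "h = mat x + scal e (\<Theta> g)" by (simp add: h(2))
    \<comment> \<open>The condition \<open>det h = 1\<close> ties \<open>x * x\<close> to
      \<open>e\<close>, so the scalar part \<open>x * x + e * e * (4 * d)\<close> of the square
      equals \<open>1 + 8 * d * e * e\<close>. This produces the new power of 2 without using how
      close \<open>x\<close> is to 1.\<close>
    have "x * x - e * e * (a * a + b * c) = 1"
      using det_in_G[OF h(1)] unfolding he det_2
      by (simp add: entries algebra_simps)
    then have det: "x * x = 1 + e * e * (4 * d)" unfolding d by (simp add: algebra_simps)
    have hh: "h ** h = mat (x * x + e * e * (4 * d)) + scal (2 ^ Suc k * (u * x)) (\<Theta> g)"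
    proof -
      have eq: "2 ^ Suc k * (u * x) = 2 * (e * x)" by (simp add: e_def)
      show ?thesis
        unfolding d[symmetric] he eq
        by (simp add: mat2_eq_iff matrix_mult_nth_2 entries algebra_simps)
    qed
    have "x * x + e * e * (4 * d) - 1 = 2 ^ (2 * Suc k + 1) * (u * u * d)"
    proof -
      have "2 * Suc k + 1 = 3 + (k + k)" by simp
      then have eq: "(2::z2) ^ (2 * Suc k + 1) = 8 * (2 ^ k * 2 ^ k)"
        by (simp only: power_add) simp
      show ?thesis unfolding det eq e_def by (simp add: algebra_simps)
    qed
    then have 1: "2 ^ (2 * Suc k + 1) dvd x * x + e * e * (4 * d) - 1" by simp
    have "2 ^ 1 dvd x - 1" using h(3) by (rule power_le_dvd) simp
    then have "2 dvd x - 1" by simp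
    then have "2 dvd u * (x - 1) + (u - 1)" using h(4) by simp
    then have "2 dvd u * x - 1" by (simp add: algebra_simps)
    with 1 hh mult_in_G[OF h(1) h(1)] show ?case by blast
  qed
qed

lemma \<Theta>_in_near:
  assumes "g \<in> G" "mat_cong 4 g (mat 1)"
  shows "\<Theta> g \<in> near G k"
proof -
  obtain h c u where h: "h \<in> G" "h = mat c + scal (2 ^ k * u) (\<Theta> g)"
    "2 ^ (2 * k + 1) dvd c - 1" "2 dvd u - 1"
    using power_two_power_in_G[OF assms] by blast
  from h(3) have "2 ^ (2 * k) dvd c - 1" by (rule power_le_dvd) simp
  then have "mat_cong (2 ^ (2 * k)) h (mat 1 + scal (2 ^ k) (scal u (\<Theta> g)))"
    unfolding h(2) by (simp add: mat_cong_def forall_2 mult.assoc)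
  then have "scal u (\<Theta> g) \<in> near G k" using h(1) unfolding near_def by blast
  then have near: "scal v (scal u (\<Theta> g)) \<in> near G k" for v by (rule near_scal)
  \<comment> \<open>An inverse of \<open>u\<close> modulo \<open>2 ^ k\<close> is enough, as
    \<open>near G k\<close> is invariant modulo \<open>2 ^ k\<close>.\<close>
  obtain v where "2 ^ k dvd v * u - 1" using odd_inverse_mod[OF h(4)] .
  then have "2 ^ k dvd (v * u - 1) * \<Theta> g $ i $ j" for i j by simp
  then have "mat_cong (2 ^ k) (scal v (scal u (\<Theta> g))) (\<Theta> g)"
    by (simp add: mat_cong_def algebra_simps)
  with near show ?thesis by (rule near_mat_cong)
qed

lemma L_subset_near:
  assumes "\<forall>g\<in>G. mat_cong 4 g (mat 1)"
  shows "L G \<subseteq> near G k"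
proof -
  \<comment> \<open>The hull ranges over subgroups of \<open>sl2\<close>, whereas
    \<open>near G k\<close> also contains matrices of nonzero trace, such as \<open>2 ^ k\<close>
    times the identity.\<close>
  let ?H = "near G k \<inter> carrier sl2"
  have "closed (near G k)" using near_mat_cong by (rule closed_if_mat_cong_invariant)
  then have "closed ?H" using closed_sl2 by (rule closed_Int)
  moreover have "subgroup ?H sl2"
  proof (rule group.subgroupI[OF group_sl2])
    have "0 \<in> ?H" using near_zero by (simp add: sl2_def trace_def)
    then show "?H \<noteq> {}" by blast
  next
    fix A assume A: "A \<in> ?H"
    have neg: "- A = scal (- 1) A" by (simp add: mat2_eq_iff)
    have tr: "- A \<in> carrier sl2"
      using A trace_sub[of 0 A] by (simp add: sl2_def trace_def)
    have "inv\<^bsub>sl2\<^esub> A = - A"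
      using A tr by (intro group.inv_equality[OF group_sl2]) (auto simp: sl2_def)
    with A tr neg near_scal[of A k "- 1"] show "inv\<^bsub>sl2\<^esub> A \<in> ?H" by simp
  next
    fix A B assume "A \<in> ?H" "B \<in> ?H"
    then show "A \<otimes>\<^bsub>sl2\<^esub> B \<in> ?H" by (auto simp: sl2_def trace_add near_add)
  qed auto
  moreover have "\<Theta> ` G \<subseteq> ?H" using assms \<Theta>_in_near \<Theta>_in_sl2 by blast
  ultimately have "L G \<subseteq> ?H" unfolding L_def by (intro hull_minimal) auto
  then show ?thesis by blast
qed

end

section \<open>Successive approximation inside the closed group\<close>

lemma B2_first_order:
  assumes "y \<in> B2 n"
  obtains X where "X \<in> carrier sl2" "mat_cong (2 ^ (2 * n)) y (mat 1 + scal (2 ^ n) X)"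
proof -
  have "2 ^ n dvd y $ 1 $ 1 - 1" "2 ^ n dvd y $ 1 $ 2" "2 ^ n dvd y $ 2 $ 1" "2 ^ n dvd y $ 2 $ 2 - 1"
    using assms by (auto simp: B2_def mat_cong_def forall_2)
  then obtain a b c d where eqs: "y $ 1 $ 1 - 1 = 2 ^ n * a" "y $ 1 $ 2 = 2 ^ n * b"
    "y $ 2 $ 1 = 2 ^ n * c" "y $ 2 $ 2 - 1 = 2 ^ n * d"
    by (elim dvdE)
  then have y: "y $ 1 $ 1 = 1 + 2 ^ n * a" "y $ 2 $ 2 = 1 + 2 ^ n * d"
    by (metis add.commute diff_add_cancel)+
  \<comment> \<open>The obvious first-order term has diagonal \<open>a\<close>, \<open>d\<close>;
    replacing \<open>a\<close> by \<open>- d\<close> makes the trace exactly zero.\<close>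
  define X :: mat2 where "X = vector [vector [- d, b], vector [c, d]]"
  have "y $ 1 $ 1 * y $ 2 $ 2 - y $ 1 $ 2 * y $ 2 $ 1 = 1"
    using assms by (simp add: B2_def SL2_def det_2)
  \<comment> \<open>Expanding the determinant shows that \<open>a + d\<close> is divisible by
    \<open>2 ^ n\<close>, so the replacement changes the matrix only modulo
    \<open>2 ^ (2 * n)\<close>.\<close>
  then have "2 ^ n * (a + d) = 2 ^ (2 * n) * (b * c - a * d)"
    unfolding y eqs by (simp add: algebra_simps mult_2 mult_2_right power_add)
  then have "2 ^ (2 * n) dvd 2 ^ n * (a + d)" by simp
  then have "mat_cong (2 ^ (2 * n)) y (mat 1 + scal (2 ^ n) X)"
    by (simp add: mat_cong_def forall_2 X_def y eqs algebra_simps)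
  moreover have "X \<in> carrier sl2" by (simp add: X_def sl2_def trace_def sum_2)
  ultimately show thesis using that by blast
qed

theorem theorem5p2:
  fixes G :: "mat2 set" and s :: nat
  assumes "subgroup G SL2"
    and "closed G"
    and "\<forall>g\<in>G. mat_cong 4 g (mat 1)"
    and "s \<ge> 2"
    and "scal (2 ^ s) ` carrier sl2 \<subseteq> L G"
  shows "B2 (6 * s) \<subseteq> G"
proof
  fix x assume x: "x \<in> B2 (6 * s)"
  have step: "\<exists>h\<in>G. mat_cong (2 ^ Suc n) h y" if y: "y \<in> B2 n" and n: "6 * s \<le> n" for y n
  proof -
    obtain X where X: "X \<in> carrier sl2" "mat_cong (2 ^ (2 * n)) y (mat 1 + scal (2 ^ n) X)"
      using B2_first_order[OF y] .
    \<comment> \<open>The level \<open>n - s\<close> compensates for the factor \<open>2 ^ s\<close>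
      lost in passing from trace-zero matrices to \<open>L G\<close>.\<close>
    have "scal (2 ^ s) X \<in> near G (n - s)"
      using assms(5) L_subset_near[OF assms(1,3)] X(1) by blast
    moreover have "scal (2 ^ (n - s)) (scal (2 ^ s) X) = scal (2 ^ n) X"
      using n by (simp add: mat2_eq_iff flip: mult.assoc power_add)
    ultimately obtain h where "h \<in> G"
      and h: "mat_cong (2 ^ (2 * (n - s))) h (mat 1 + scal (2 ^ n) X)"
      unfolding near_def by auto
    \<comment> \<open>Precision is gained because \<open>2 * (n - s) \<ge> Suc n\<close>, by
      \<open>n \<ge> 6 * s\<close> and \<open>s \<ge> 2\<close>.\<close>
    have "mat_cong (2 ^ Suc n) h (mat 1 + scal (2 ^ n) X)"
      using h by (rule mat_cong_dvd) (use n assms(4) in \<open>intro le_imp_power_dvd, linarith\<close>)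
    moreover have "mat_cong (2 ^ Suc n) y (mat 1 + scal (2 ^ n) X)"
      using X(2) by (rule mat_cong_dvd) (use n assms(4) in \<open>intro le_imp_power_dvd, linarith\<close>)
    ultimately show ?thesis using \<open>h \<in> G\<close> mat_cong_sym mat_cong_trans by blast
  qed
  have "\<exists>h\<in>G. mat_cong (2 ^ (6 * s + m)) h x" for m
  proof (induction m)
    case 0
    show ?case using x one_in_G[OF assms(1)] by (auto simp: B2_def intro: mat_cong_sym)
  next
    case (Suc m)
    then obtain h where h: "h \<in> G" "mat_cong (2 ^ (6 * s + m)) h x" by blast
    interpret group SL2 by (rule group_SL2)
    have in_SL2: "h \<in> carrier SL2" "x \<in> carrier SL2"
      using h(1) subgroup.subset[OF assms(1)] x by (auto simp: B2_def)
    \<comment> \<open>The error of the approximation \<open>h\<close> is the quotient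
      \<open>y\<close>. It is trivial to the precision reached so far, so \<open>step\<close>
      approximates it by some \<open>k\<close> in \<open>G\<close> one power of 2 further, and
      \<open>h ** k\<close> improves on \<open>h\<close>.\<close>
    define y where "y = inv\<^bsub>SL2\<^esub> h \<otimes>\<^bsub>SL2\<^esub> x"
    have "y \<in> carrier SL2" using in_SL2 by (simp add: y_def)
    have "h \<otimes>\<^bsub>SL2\<^esub> y = x" using in_SL2 by (simp add: y_def flip: m_assoc)
    then have hy: "h ** y = x" by (simp add: SL2_def)
    have "inv\<^bsub>SL2\<^esub> h ** h = mat 1" using l_inv[OF in_SL2(1)] by (simp add: SL2_def)
    moreover have "y = inv\<^bsub>SL2\<^esub> h ** x" by (simp add: y_def SL2_def)
    ultimately have "mat_cong (2 ^ (6 * s + m)) y (mat 1)"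
      using mat_cong_mult[OF mat_cong_refl mat_cong_sym[OF h(2)]] by metis
    with \<open>y \<in> carrier SL2\<close> have "y \<in> B2 (6 * s + m)" by (simp add: B2_def)
    then obtain k where k: "k \<in> G" "mat_cong (2 ^ Suc (6 * s + m)) k y" using step by force
    have "mat_cong (2 ^ (6 * s + Suc m)) (h ** k) x"
      using mat_cong_mult[OF mat_cong_refl k(2), of h] hy by simp
    with mult_in_G[OF assms(1) h(1) k(1)] show ?case by blast
  qed
  \<comment> \<open>Elements of \<open>G\<close> approximate \<open>x\<close> to every precision, so
    \<open>x\<close> lies in the closed set \<open>G\<close>.\<close>
  then have "\<exists>h\<in>G. mat_cong (2 ^ m) h x" for m
    by (meson mat_cong_dvd le_imp_power_dvd le_add2)
  then show "x \<in> G" using closed_mat_cong_approx[OF assms(2)] by blast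
qed

end
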